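(* Let $G$ be a graph with $n$ vertices. Then the transition $q$-spectrum of $G$ recovers the Laplacian spectrum of $G$ by taking the limit of $-(\lambda-1)/q$ as $q\to0$. That is, if $\lambda_1(q)\ge\dots\ge\lambda_n(q)$ are the eigenvalues (which are real) of the transition similarity matrix $P(q)$ of $G$ (with multiplicity) for $q\in(0,1)$, and $\theta_1\le\dots\le\theta_n$ are the eigenvalues of the Laplacian matrix of $G$ (with multiplicity), then $\lim_{q\to0^+}-(\lambda_i(q)-1)/q=\theta_i$ for every $i$.
   Context: Graphs are finite, connected, undirected and simple. The vertex set $\{x_1,\dots,x_n\}$ of a graph is regarded as a finite metric space with $d_{ij}=d(x_i,x_j)$ the length of a shortest path between $x_i$ and $x_j$. With $\pi_i=\sum_{j=1}^n q^{d_{ij}}$, the transition similarity matrix is $P(q)=(q^{d_{ij}}/\pi_i)_{i,j}$, and the transition $q$-spectrum is the multiset of its eigenvalues. The Laplacian matrix is $L=D-A$, where $A$ is the adjacency matrix and $D$ the diagonal matrix of vertex degrees; the Laplacian spectrum is the multiset of eigenvalues of $L$. *)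

theory Defs
  imports
    "HOL-Analysis.Analysis"
    "HOL-Computational_Algebra.Computational_Algebra"
    "Graph_Theory.Digraph_Component"
    "Jordan_Normal_Form.Char_Poly"
begin

text \<open>
  Finite simple undirected graphs are the \<^locale>\<open>graph\<close>s of Graph Theory: every
  edge is a pair of opposite arcs, there are no loops and no parallel arcs. In the
  definitions below, \<open>x 0, \<dots>, x (n - 1)\<close> enumerates the vertices.
\<close>

text \<open>An \<open>apath\<close> repeats no vertex; its length is its number of arcs.\<close>

definition graph_dist :: "('a, 'b) pre_digraph \<Rightarrow> 'a \<Rightarrow> 'a \<Rightarrow> nat" where
  "graph_dist G u v = (LEAST k. \<exists>p. pre_digraph.apath G u p v \<and> length p = k)"

definition transition_similarity_matrix ::
    "('a, 'b) pre_digraph \<Rightarrow> nat \<Rightarrow> (nat \<Rightarrow> 'a) \<Rightarrow> real \<Rightarrow> real mat" where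
  "transition_similarity_matrix G n x q =
     mat n n (\<lambda>(i, j). q ^ graph_dist G (x i) (x j) / (\<Sum>k<n. q ^ graph_dist G (x i) (x k)))"

definition adjacency_matrix :: "('a, 'b) pre_digraph \<Rightarrow> nat \<Rightarrow> (nat \<Rightarrow> 'a) \<Rightarrow> real mat" where
  "adjacency_matrix G n x = mat n n (\<lambda>(i, j). if x i \<rightarrow>\<^bsub>G\<^esub> x j then 1 else 0)"

text \<open>In a symmetric loopfree digraph without parallel arcs, the out-degree of a vertex
  is its number of neighbours.\<close>

definition degree_matrix :: "('a, 'b) pre_digraph \<Rightarrow> nat \<Rightarrow> (nat \<Rightarrow> 'a) \<Rightarrow> real mat" where
  "degree_matrix G n x = mat n n (\<lambda>(i, j). if i = j then real (out_degree G (x i)) else 0)"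

definition laplacian_matrix :: "('a, 'b) pre_digraph \<Rightarrow> nat \<Rightarrow> (nat \<Rightarrow> 'a) \<Rightarrow> real mat" where
  "laplacian_matrix G n x = degree_matrix G n x - adjacency_matrix G n x"

text \<open>All complex eigenvalues of a real matrix, with algebraic multiplicity, so that
  being real is a property to be proved.\<close>

definition eigenvalue_mset :: "real mat \<Rightarrow> complex multiset" where
  "eigenvalue_mset A = proots (char_poly (map_mat complex_of_real A))"

definition lists_eigenvalues :: "real mat \<Rightarrow> nat \<Rightarrow> (nat \<Rightarrow> real) \<Rightarrow> bool" where
  "lists_eigenvalues A n f \<longleftrightarrow>
     image_mset (\<lambda>i. complex_of_real (f i)) (mset_set {..<n}) = eigenvalue_mset A"

end

(* The matrix (I - P(q)) / q converges entrywise to L as q -> 0+, because the powers q^d with d >= 2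
   do not contribute in the limit. Its eigenvalues are mu_i(q) = -(lambda_i(q) - 1) / q, so the
   products of all z - mu_i(q) converge to the product of all z - theta_i at every complex z.
   For real roots this forces convergence of the ordered roots: at the imaginary unit z every factor has
   modulus at least 1, hence the mu_i(q) stay bounded, and by compactness it suffices that each cluster
   point is an increasing enumeration of the roots of the limit polynomial. The eigenvalues are real
   since P(q) becomes symmetric after multiplication by the diagonal matrix of the pi_i. *)

theory Submission
  imports Defs
begin

section \<open>Convergence of ordered real roots\<close>

text \<open>Agreement at every complex point makes the two polynomials equal, hence their root
  multisets; a sorted list is determined by its multiset.\<close>

lemma sorted_roots_unique:
  fixes f g :: "nat \<Rightarrow> real"
  assumes "mono_on {..<n} f" "mono_on {..<n} g"
    and eq: "\<And>z::complex. (\<Prod>i<n. z - of_real (f i)) = (\<Prod>i<n. z - of_real (g i))"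
    and "i < n"
  shows "f i = g i"
proof -
  define p where "p h = (\<Prod>i<n. [:- complex_of_real (h i), 1:])" for h
  have roots: "proots (p h) = image_mset (\<lambda>i. complex_of_real (h i)) (mset_set {..<n})" for h
    unfolding p_def by (subst proots_prod) (auto simp: sum_unfold_sum_mset image_mset.compositionality o_def)
  have "poly (p f) = poly (p g)"
    using eq by (auto simp: p_def poly_prod)
  hence "p f = p g"
    by (simp add: poly_eq_poly_eq_iff)
  hence "image_mset (\<lambda>i. complex_of_real (f i)) (mset_set {..<n}) = image_mset (\<lambda>i. complex_of_real (g i)) (mset_set {..<n})"
    using roots by metis
  hence "image_mset Re (image_mset (\<lambda>i. complex_of_real (f i)) (mset_set {..<n})) = image_mset Re (image_mset (\<lambda>i. complex_of_real (g i)) (mset_set {..<n}))"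
    by simp
  hence "mset (map f [0..<n]) = mset (map g [0..<n])"
    by (simp add: image_mset.compositionality o_def atLeast0LessThan)
  moreover have "sorted (map f [0..<n])" "sorted (map g [0..<n])"
    using assms(1,2) by (auto simp: sorted_iff_nth_mono mono_on_def)
  ultimately have "map f [0..<n] = map g [0..<n]"
    by (metis properties_for_sort)
  thus ?thesis using \<open>i < n\<close> by simp
qed

text \<open>Tychonoff's theorem: a product of compact intervals. Root vectors are treated as
  functions on all of \<open>nat\<close>, so every coordinate is bounded here.\<close>

lemma compact_cube: "compact {h :: nat \<Rightarrow> real. \<forall>i. h i \<in> {a..b}}"
proof -
  have "compactin (product_topology (\<lambda>_::nat. euclidean :: real topology) UNIV) (PiE UNIV (\<lambda>_. {a..b}))"
    by (subst compactin_PiE) auto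
  thus ?thesis
    by (simp add: euclidean_product_topology PiE_def Pi_def)
qed

text \<open>If the claim failed, restricting \<open>F\<close> to the bad parameters would yield a
  cluster point \<open>g\<close> of the root vectors. It is sorted and has the same product as
  \<theta> at every \<open>z\<close>, so it agrees with \<theta> below \<open>n\<close>, yet its
  coordinate \<open>i\<close> would have to stay away from \<open>\<theta> i\<close>.\<close>

lemma tendsto_sorted_roots:
  fixes r :: "'x \<Rightarrow> nat \<Rightarrow> real"
  assumes mono_r: "eventually (\<lambda>q. mono_on {..<n} (r q)) F" and mono_t: "mono_on {..<n} \<theta>"
    and lim: "\<And>z::complex. ((\<lambda>q. \<Prod>i<n. z - of_real (r q i)) \<longlongrightarrow> (\<Prod>i<n. z - of_real (\<theta> i))) F"
    and i: "i < n"
  shows "((\<lambda>q. r q i) \<longlongrightarrow> \<theta> i) F"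
proof (rule ccontr)
  assume "\<not> ?thesis"
  then obtain U where U: "open U" "\<theta> i \<in> U" and not_ev: "\<not> eventually (\<lambda>q. r q i \<in> U) F"
    by (auto simp: tendsto_def)
  \<comment> \<open>Padding with 0 from \<open>n\<close> on places the whole function in the compact
    cube \<open>K\<close>.\<close>
  define f where "f q = (\<lambda>j. if j < n then r q j else 0)" for q
  define \<Phi> where "\<Phi> z h = (\<Prod>j<n. z - complex_of_real (h j))" for z h
  define B where "B = norm (\<Phi> \<i> \<theta>) + 1"
  define K where "K = {h :: nat \<Rightarrow> real. \<forall>j. h j \<in> {-B..B}}"
  have \<Phi>_f: "\<Phi> z (f q) = (\<Prod>j<n. z - of_real (r q j))" for z q
    by (simp add: \<Phi>_def f_def)
  have "eventually (\<lambda>q. norm (\<Phi> \<i> (f q)) < B) F"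
    unfolding \<Phi>_f by (rule order_tendstoD(2)[OF tendsto_norm[OF lim]]) (simp add: B_def \<Phi>_def)
  hence ev_K: "eventually (\<lambda>q. f q \<in> K) F"
  proof eventually_elim
    case (elim q)
    have "\<bar>r q j\<bar> \<le> B" if "j < n" for j
    proof -
      have ge1: "1 \<le> norm (\<i> - complex_of_real (r q k))" for k
        using abs_Im_le_cmod[of "\<i> - complex_of_real (r q k)"] by simp
      have "\<bar>r q j\<bar> \<le> norm (\<i> - complex_of_real (r q j))"
        using abs_Re_le_cmod[of "\<i> - complex_of_real (r q j)"] by simp
      \<comment> \<open>The other factors are at least 1, so the whole product dominates each single
        factor.\<close>
      also have "\<dots> \<le> norm (\<i> - complex_of_real (r q j)) * (\<Prod>k\<in>{..<n}-{j}. norm (\<i> - complex_of_real (r q k)))"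
        using prod_ge_1[of "{..<n}-{j}" "\<lambda>k. norm (\<i> - complex_of_real (r q k))"] ge1
        by (simp add: mult_le_cancel_left1)
      also have "\<dots> = norm (\<Phi> \<i> (f q))"
        using that by (simp add: \<Phi>_f prod_norm prod.remove[of "{..<n}" j] norm_mult)
      finally show ?thesis using elim by simp
    qed
    moreover have "0 \<le> B" by (simp add: B_def)
    ultimately show ?case unfolding K_def f_def by (auto simp: abs_le_iff minus_le_iff)
  qed
  \<comment> \<open>The bad parameters are frequent in \<open>F\<close>, so this restriction is a
    proper filter.\<close>
  define F' where "F' = inf F (principal {q. r q i \<notin> U})"
  have F': "F' \<noteq> bot" "F' \<le> F"
    using not_ev by (auto simp: F'_def trivial_limit_def eventually_inf_principal)
  have "eventually (\<lambda>h. h \<in> K) (filtermap f F')"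
    using ev_K F'(2) by (simp add: eventually_filtermap filter_leD)
  then obtain g where nb: "inf (nhds g) (filtermap f F') \<noteq> bot"
    using compact_cube[of "-B" B] F'(1) unfolding K_def compact_filter
    by (metis (mono_tags, lifting) filtermap_bot_iff)
  \<comment> \<open>\<open>H\<close> plays the role of a convergent subsequence: along it points
    tend to \<open>g\<close>, and every property of \<open>f q\<close> that holds eventually in
    \<open>F'\<close> persists.\<close>
  define H where "H = inf (nhds g) (filtermap f F')"
  have H: "H \<noteq> bot" "H \<le> nhds g" "H \<le> filtermap f F'"
    using nb by (auto simp: H_def)
  have coord: "((\<lambda>h. h j) \<longlongrightarrow> g j) H" for j
  proof -
    have "((\<lambda>h. h j) \<longlongrightarrow> g j) (nhds g)"
    proof -
      have "continuous_on UNIV (\<lambda>h :: nat \<Rightarrow> real. h j)" by simp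
      hence "isCont (\<lambda>h :: nat \<Rightarrow> real. h j) g"
        using continuous_on_eq_continuous_at[OF open_UNIV] by blast
      thus ?thesis by (simp only: isCont_def tendsto_at_iff_tendsto_nhds[of "\<lambda>h. h j"])
    qed
    thus ?thesis using H(2) by (rule tendsto_mono[rotated])
  qed
  have H_ev: "eventually P H" if "eventually (\<lambda>q. P (f q)) F'" for P
    using that H(3) by (simp add: eventually_filtermap filter_leD)
  \<comment> \<open>Two limits of the same function along \<open>H\<close>: one by continuity at
    \<open>g\<close>, one inherited from \<open>F\<close>.\<close>
  have "\<Phi> z g = \<Phi> z \<theta>" for z
  proof (rule tendsto_unique[OF H(1)])
    show "(\<Phi> z \<longlongrightarrow> \<Phi> z g) H"
      unfolding \<Phi>_def by (intro tendsto_intros coord)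
    have "((\<lambda>q. \<Phi> z (f q)) \<longlongrightarrow> \<Phi> z \<theta>) F'"
      using lim[of z] F'(2) by (simp add: \<Phi>_f \<Phi>_def[of z \<theta>] tendsto_mono)
    thus "(\<Phi> z \<longlongrightarrow> \<Phi> z \<theta>) H"
      using H(3) by (metis filterlim_filtermap tendsto_mono)
  qed
  moreover have "mono_on {..<n} g"
  proof (rule mono_onI)
    fix j k assume jk: "j \<in> {..<n}" "k \<in> {..<n}" "j \<le> k"
    have "eventually (\<lambda>h. h j \<le> h k) H"
    proof (intro H_ev filter_leD[OF F'(2)])
      show "eventually (\<lambda>q. f q j \<le> f q k) F"
        using mono_r by eventually_elim (use jk in \<open>auto simp: f_def mono_on_def\<close>)
    qed
    thus "g j \<le> g k" using tendsto_le[OF H(1) coord coord] by blast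
  qed
  ultimately have "g i = \<theta> i"
    using sorted_roots_unique[OF _ mono_t _ i] by (simp add: \<Phi>_def)
  hence "eventually (\<lambda>h. h i \<in> U) H"
    using coord[of i] U by (metis topological_tendstoD)
  moreover have "eventually (\<lambda>h. h i \<notin> U) H"
    by (rule H_ev) (simp add: F'_def eventually_inf_principal f_def i)
  ultimately have "eventually (\<lambda>_. False) H"
    by eventually_elim simp
  thus False using H(1) by simp
qed

section \<open>Real eigenvalues and characteristic determinants\<close>

text \<open>Such a matrix is self-adjoint for the inner product with weights \<open>w\<close>. For
  an eigenvector \<open>u\<close>, the form \<open>S\<close> equals the eigenvalue times the
  positive number \<open>N\<close>, and \<open>S\<close> is its own conjugate.\<close>

lemma eigenvalues_real_if_symmetrizable:
  assumes A: "A \<in> carrier_mat n n"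
    and pos: "\<And>i. i < n \<Longrightarrow> w i > 0"
    and sym: "\<And>i j. i < n \<Longrightarrow> j < n \<Longrightarrow> w i * A $$ (i, j) = w j * A $$ (j, i)"
  shows "set_mset (eigenvalue_mset A) \<subseteq> \<real>"
proof
  define C where "C = map_mat complex_of_real A"
  have C: "C \<in> carrier_mat n n" using A by (simp add: C_def)
  fix \<mu> assume "\<mu> \<in># eigenvalue_mset A"
  moreover have "char_poly C \<noteq> 0"
    using degree_monic_char_poly[OF C] by auto
  ultimately have "eigenvalue C \<mu>"
    unfolding eigenvalue_root_char_poly[OF C] by (simp add: eigenvalue_mset_def C_def)
  then obtain v where v: "v \<in> carrier_vec n" "v \<noteq> 0\<^sub>v n" "C *\<^sub>v v = \<mu> \<cdot>\<^sub>v v"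
    using C by (auto simp: eigenvalue_def eigenvector_def)
  define u where "u = vec_index v"
  have row: "(\<Sum>j<n. of_real (A $$ (i, j)) * u j) = \<mu> * u i" if "i < n" for i
  proof -
    have "vec_index (C *\<^sub>v v) i = vec_index (\<mu> \<cdot>\<^sub>v v) i" by (simp add: v)
    thus ?thesis using that v(1) A by (simp add: C_def u_def scalar_prod_def atLeast0LessThan)
  qed
  define N where "N = (\<Sum>i<n. w i * (cmod (u i))\<^sup>2)"
  define S where "S = (\<Sum>i<n. \<Sum>j<n. cnj (u i) * of_real (w i * A $$ (i, j)) * u j)"
  obtain k where "k < n" "u k \<noteq> 0"
    unfolding u_def using v(1,2) by (metis carrier_vecD eq_vecI index_zero_vec)
  hence "N > 0"
    unfolding N_def using pos by (intro sum_pos2[of _ k]) (auto simp: less_imp_le)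
  have S: "S = \<mu> * of_real N"
  proof -
    have "S = (\<Sum>i<n. cnj (u i) * of_real (w i) * (\<Sum>j<n. of_real (A $$ (i, j)) * u j))"
      by (simp add: S_def sum_distrib_left mult.assoc)
    also have "\<dots> = (\<Sum>i<n. \<mu> * of_real (w i * (cmod (u i))\<^sup>2))"
    proof (intro sum.cong refl)
      fix i assume "i \<in> {..<n}"
      hence "cnj (u i) * of_real (w i) * (\<Sum>j<n. of_real (A $$ (i, j)) * u j) =
          \<mu> * (of_real (w i) * (u i * cnj (u i)))"
        by (simp add: row)
      thus "cnj (u i) * of_real (w i) * (\<Sum>j<n. of_real (A $$ (i, j)) * u j) =
          \<mu> * of_real (w i * (cmod (u i))\<^sup>2)"
        by (simp add: complex_norm_square del: of_real_power)
    qed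
    finally show ?thesis by (simp add: N_def sum_distrib_left)
  qed
  \<comment> \<open>Conjugation exchanges the roles of \<open>i\<close> and \<open>j\<close>; the
    symmetry of the weighted entries undoes this.\<close>
  have "cnj S = (\<Sum>i<n. \<Sum>j<n. cnj (u j) * of_real (w i * A $$ (i, j)) * u i)"
    by (simp add: S_def mult_ac)
  also have "\<dots> = (\<Sum>i<n. \<Sum>j<n. cnj (u j) * of_real (w j * A $$ (j, i)) * u i)"
    by (intro sum.cong refl) (simp add: sym)
  also have "\<dots> = S"
    unfolding S_def by (rule sum.swap)
  finally have "cnj \<mu> = \<mu>"
    using \<open>N > 0\<close> by (simp add: S)
  thus "\<mu> \<in> \<real>" by (simp add: Reals_cnj_iff)
qed

lemma poly_char_poly:
  assumes "A \<in> carrier_mat n n"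
  shows "poly (char_poly A) (z :: 'a :: field) = det (mat n n (\<lambda>(i, j). (if i = j then z else 0) - A $$ (i, j)))"
  unfolding char_poly_matrix[OF assms]
  by (rule arg_cong[where f = det], rule eq_matI) (use assms in \<open>auto simp: char_matrix_def\<close>)

text \<open>Over the complex numbers the monic characteristic polynomial splits into the linear
  factors of its root multiset. This trades eigenvalues for a determinant in the entries.\<close>

lemma lists_eigenvalues_prod:
  assumes A: "A \<in> carrier_mat n n" and "lists_eigenvalues A n f"
  shows "(\<Prod>i<n. z - complex_of_real (f i)) =
    det (mat n n (\<lambda>(i, j). (if i = j then z else 0) - complex_of_real (A $$ (i, j))))"
proof -
  let ?C = "map_mat complex_of_real A"
  have C: "?C \<in> carrier_mat n n" using A by simp
  have "char_poly ?C = (\<Prod>r\<in>#proots (char_poly ?C). [:- r, 1:])"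
    using complex_poly_decompose_multiset[of "char_poly ?C"] degree_monic_char_poly[OF C] by simp
  also have "proots (char_poly ?C) = image_mset (\<lambda>i. complex_of_real (f i)) (mset_set {..<n})"
    using assms(2) by (simp add: lists_eigenvalues_def eigenvalue_mset_def)
  finally have "char_poly ?C = (\<Prod>i<n. [:- complex_of_real (f i), 1:])"
    by (simp add: image_mset.compositionality o_def prod_unfold_prod_mset)
  hence "(\<Prod>i<n. z - complex_of_real (f i)) = poly (char_poly ?C) z"
    by (simp add: poly_prod)
  also have "\<dots> = det (mat n n (\<lambda>(i, j). (if i = j then z else 0) - complex_of_real (A $$ (i, j))))"
    unfolding poly_char_poly[OF C]
    by (rule arg_cong[where f = det], rule eq_matI) (use A in auto)
  finally show ?thesis .
qed

text \<open>By the Leibniz formula the determinant is a finite sum of products of entries.\<close>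

lemma tendsto_det_mat:
  fixes B :: "nat \<Rightarrow> nat \<Rightarrow> complex"
  assumes "\<And>i j. i < n \<Longrightarrow> j < n \<Longrightarrow> ((\<lambda>q. A q i j) \<longlongrightarrow> B i j) F"
  shows "((\<lambda>q. det (mat n n (\<lambda>(i, j). A q i j))) \<longlongrightarrow> det (mat n n (\<lambda>(i, j). B i j))) F"
proof -
  have det: "det (mat n n (\<lambda>(i, j). M i j)) = (\<Sum>p | p permutes {0..<n}. signof p * (\<Prod>i = 0..<n. M i (p i)))"
    for M :: "nat \<Rightarrow> nat \<Rightarrow> complex"
    by (subst det_def'[of _ n]) (auto intro!: sum.cong prod.cong dest: permutes_in_image)
  show ?thesis
    unfolding det by (intro tendsto_intros assms) (auto dest: permutes_in_image)
qed

text \<open>The identity \<open>(1 - q z) I - P = - q (z I - (I - P) / q)\<close> relates the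
  characteristic determinant of \<open>P\<close> to that of the rescaled matrix.\<close>

lemma det_char_shift:
  assumes "q \<noteq> 0"
  shows "det (mat n n (\<lambda>(i, j). (if i = j then 1 - q * z else 0) - P i j)) =
    (- q) ^ n * det (mat n n (\<lambda>(i, j). (if i = j then z else 0) - ((if i = j then 1 else 0) - P i j) / (q :: complex)))"
    (is "det ?L = _ * det ?R")
proof -
  have "?L = (- q) \<cdot>\<^sub>m ?R"
    using assms by (intro eq_matI) (auto simp: field_simps)
  thus ?thesis by simp
qed

section \<open>Entrywise limit of the rescaled transition matrix\<close>

text \<open>The row sum is \<open>s = 1 + q t\<close>, where \<open>t\<close> tends to the number of
  indices at distance 1. The diagonal entry is then \<open>t / s\<close> and an off-diagonal one is
  \<open>- q ^ (d i j - 1) / s\<close>, with \<open>s\<close> tending to 1.\<close>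

lemma tendsto_transition_entry:
  fixes d :: "nat \<Rightarrow> nat \<Rightarrow> nat"
  assumes d0: "\<And>i j. i < n \<Longrightarrow> j < n \<Longrightarrow> d i j = 0 \<longleftrightarrow> i = j" and ij: "i < n" "j < n"
  shows "((\<lambda>q::real. ((if i = j then 1 else 0) - q ^ d i j / (\<Sum>k<n. q ^ d i k)) / q) \<longlongrightarrow>
    (if i = j then real (card {k. k < n \<and> d i k = 1}) else - (if d i j = 1 then 1 else 0))) (at_right 0)"
proof -
  define s where "s q = (\<Sum>k<n. q ^ d i k)" for q :: real
  \<comment> \<open>Removing \<open>k = i\<close> leaves only positive distances, so the natural
    subtraction does not truncate.\<close>
  define t where "t q = (\<Sum>k\<in>{..<n} - {i}. q ^ (d i k - 1))" for q :: real
  have pow: "((\<lambda>q::real. q ^ m) \<longlongrightarrow> (if m = 0 then 1 else 0)) (at_right 0)" for m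
  proof -
    have "((\<lambda>q::real. q ^ m) \<longlongrightarrow> 0 ^ m) (at_right 0)"
      by (intro tendsto_intros)
    thus ?thesis by (simp add: power_0_left)
  qed
  have s_split: "s q = 1 + q * t q" for q
  proof -
    have "s q = q ^ d i i + (\<Sum>k\<in>{..<n} - {i}. q ^ d i k)"
      unfolding s_def using ij by (intro sum.remove) auto
    also have "(\<Sum>k\<in>{..<n} - {i}. q ^ d i k) = q * t q"
      unfolding t_def sum_distrib_left
      by (intro sum.cong refl) (use d0[OF ij(1)] in \<open>auto simp: power_eq_if\<close>)
    finally show ?thesis using d0[of i i] ij by simp
  qed
  have t_lim: "(t \<longlongrightarrow> real (card {k. k < n \<and> d i k = 1})) (at_right 0)"
  proof -
    have "(t \<longlongrightarrow> (\<Sum>k\<in>{..<n} - {i}. if d i k - 1 = 0 then 1 else 0)) (at_right 0)"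
      unfolding t_def by (intro tendsto_sum pow)
    also have "(\<Sum>k\<in>{..<n} - {i}. if d i k - 1 = 0 then 1 else 0) = real (card (({..<n} - {i}) \<inter> {k. d i k - 1 = 0}))"
      by (simp add: sum.If_cases)
    also have "({..<n} - {i}) \<inter> {k. d i k - 1 = 0} = {k. k < n \<and> d i k = 1}"
      using d0[OF ij(1)] d0[OF ij(1) ij(1)] by (auto simp: le_Suc_eq)
    finally show ?thesis .
  qed
  have s_lim: "(s \<longlongrightarrow> 1) (at_right 0)"
    unfolding s_split using tendsto_add[OF tendsto_const tendsto_mult[OF tendsto_ident_at t_lim]] by simp
  have ev: "eventually (\<lambda>q::real. 0 < q) (at_right 0)"
    by (simp add: eventually_at_right_less)
  have s_pos: "s q > 0" if "q > 0" for q
    unfolding s_def using that ij by (intro sum_pos) auto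
  show ?thesis
  proof (cases "i = j")
    case True
    have "((\<lambda>q. t q / s q) \<longlongrightarrow> real (card {k. k < n \<and> d i k = 1}) / 1) (at_right 0)"
      by (intro tendsto_divide t_lim s_lim) simp
    moreover have "eventually (\<lambda>q. t q / s q = (1 - q ^ d i j / s q) / q) (at_right 0)"
      using ev
    proof eventually_elim
      case (elim q)
      thus ?case using s_pos[OF elim] d0[of i i] ij True by (simp add: field_simps) (simp add: s_split algebra_simps)
    qed
    ultimately have "((\<lambda>q. (1 - q ^ d i j / s q) / q) \<longlongrightarrow> real (card {k. k < n \<and> d i k = 1}) / 1) (at_right 0)"
      by (rule Lim_transform_eventually)
    thus ?thesis using True unfolding s_def[symmetric] by simp
  next
    case False
    hence d: "d i j \<noteq> 0" using d0 ij by simp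
    \<comment> \<open>Division by \<open>q\<close> lowers the exponent by one; the limit is nonzero
      exactly at distance 1.\<close>
    have "((\<lambda>q. - (q ^ (d i j - 1) / s q)) \<longlongrightarrow> - ((if d i j - 1 = 0 then 1 else 0) / 1)) (at_right 0)"
      by (intro tendsto_minus tendsto_divide pow s_lim) simp
    moreover have "eventually (\<lambda>q. - (q ^ (d i j - 1) / s q) = (0 - q ^ d i j / s q) / q) (at_right 0)"
      using ev
    proof eventually_elim
      case (elim q)
      thus ?case using s_pos[OF elim] d by (simp add: field_simps power_eq_if)
    qed
    ultimately have "((\<lambda>q. (0 - q ^ d i j / s q) / q) \<longlongrightarrow> - ((if d i j - 1 = 0 then 1 else 0) / 1)) (at_right 0)"
      by (rule Lim_transform_eventually)
    moreover have "d i j - 1 = 0 \<longleftrightarrow> d i j = 1" using d by linarith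
    ultimately show ?thesis using False unfolding s_def[symmetric] by simp
  qed
qed

section \<open>Graph distance and degrees\<close>

text \<open>Reverse the tail of the walk and append an arc opposite to its first arc. Tracking the
  vertex list lets distinctness and length carry over to the reversed walk.\<close>

lemma (in sym_digraph) awalk_reverse:
  assumes "awalk u p v"
  shows "\<exists>p'. awalk v p' u \<and> awalk_verts v p' = rev (awalk_verts u p)"
  using assms
proof (induction p arbitrary: u)
  case Nil
  then show ?case by (intro exI[of _ "[]"]) (auto simp: awalk_Nil_iff)
next
  case (Cons e es)
  hence e: "e \<in> arcs G" "tail G e = u" and "awalk (head G e) es v"
    by (auto simp: awalk_Cons_iff)
  then obtain p' where p': "awalk v p' (head G e)" "awalk_verts v p' = rev (awalk_verts (head G e) es)"
    using Cons.IH by blast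
  obtain e' where e': "e' \<in> arcs G" "tail G e' = head G e" "head G e' = u"
    using sym_arcs e unfolding symmetric_conv by metis
  have "awalk v (p' @ [e']) u"
  proof -
    have "awlast v p' = head G e" using p'(1) by blast
    thus ?thesis using p'(1) e' e
      by (simp add: awalk_Cons_iff awalk_Nil_iff awalk_append_iff) (metis tail_in_verts)
  qed
  moreover have "awalk_verts v (p' @ [e']) = awalk_verts v p' @ [u]"
    using p'(1) e' by (auto simp: awalk_verts_conv awalk_def)
       (metis awalk_def awlast_if_cas awalk_verts_conv last_snoc p'(1))+
  ultimately show ?case
    using p'(2) e(2) by (intro exI[of _ "p' @ [e']"]) simp
qed

lemma (in sym_digraph) graph_dist_commute: "graph_dist G u v = graph_dist G v u"
proof -
  have "\<exists>p'. apath v p' u \<and> length p' = length p" if "apath u p v" for u v p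
  proof -
    obtain p' where "awalk v p' u" "awalk_verts v p' = rev (awalk_verts u p)"
      using awalk_reverse \<open>apath u p v\<close> unfolding apath_def by blast
    moreover from this(2) have "length p' = length p"
      using length_awalk_verts by (metis length_rev nat.inject)
    ultimately show ?thesis
      using \<open>apath u p v\<close> unfolding apath_def by auto
  qed
  hence "(\<exists>p. apath u p v \<and> length p = k) \<longleftrightarrow> (\<exists>p. apath v p u \<and> length p = k)" for k
    by metis
  thus ?thesis by (simp add: graph_dist_def)
qed

context wf_digraph
begin

text \<open>Reachability supplies a path, so the least length is attained.\<close>

lemma graph_dist_apath:
  assumes "u \<rightarrow>\<^sup>* v"
  obtains p where "apath u p v" "length p = graph_dist G u v"
  using LeastI_ex[of "\<lambda>k. \<exists>p. apath u p v \<and> length p = k"] assms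
  unfolding graph_dist_def reachable_apath by auto

lemma graph_dist_le: "apath u p v \<Longrightarrow> graph_dist G u v \<le> length p"
  unfolding graph_dist_def by (rule Least_le) blast

lemma graph_dist_eq_0_iff:
  assumes "u \<rightarrow>\<^sup>* v"
  shows "graph_dist G u v = 0 \<longleftrightarrow> u = v"
proof
  assume "graph_dist G u v = 0"
  with graph_dist_apath[OF assms] show "u = v" by (metis apath_Nil_iff length_0_conv)
next
  assume "u = v"
  thus "graph_dist G u v = 0"
    using graph_dist_le[of u "[]" v] reachable_in_verts(1)[OF assms] by (simp add: apath_Nil_iff)
qed

text \<open>A path of length 1 is a single arc; conversely an arc between distinct vertices is such
  a path, and distance 0 is ruled out.\<close>

lemma graph_dist_eq_1_iff:
  assumes "u \<rightarrow>\<^sup>* v" "u \<noteq> v"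
  shows "graph_dist G u v = 1 \<longleftrightarrow> u \<rightarrow> v"
proof
  assume d: "graph_dist G u v = 1"
  obtain p where p: "apath u p v" "length p = graph_dist G u v"
    using graph_dist_apath[OF assms(1)] .
  with d obtain e where "p = [e]" by (auto simp: length_Suc_conv)
  with p show "u \<rightarrow> v" by (auto simp: apath_simps intro: in_arcs_imp_in_arcs_ends)
next
  assume "u \<rightarrow> v"
  then obtain e where "e \<in> arcs G" "tail G e = u" "head G e = v" by auto
  hence "apath u [e] v" using \<open>u \<noteq> v\<close> by (auto simp: apath_simps)
  from graph_dist_le[OF this] graph_dist_eq_0_iff[OF assms(1)] \<open>u \<noteq> v\<close>
  show "graph_dist G u v = 1" by simp
qed

end

text \<open>Without parallel arcs, an arc leaving \<open>u\<close> is determined by its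
  head.\<close>

lemma (in digraph) out_degree_eq_card: "out_degree G u = card {v. u \<rightarrow> v}"
proof -
  have "bij_betw (head G) (out_arcs G u) {v. u \<rightarrow> v}"
    by (auto simp: bij_betw_def inj_on_def arc_to_ends_def arcs_ends_conv intro!: no_multi_arcs)
  thus ?thesis unfolding out_degree_def by (rule bij_betw_same_card)
qed

section \<open>From the transition spectrum to the Laplacian spectrum\<close>

text \<open>The two reality claims guarantee that ordered real listings \<open>lam\<close> and
  \<theta> exist; the limit is asserted for any such listings.\<close>

theorem proposition2p4:
  fixes G :: "('a, 'b) pre_digraph" and n :: nat and x :: "nat \<Rightarrow> 'a"
  assumes "graph G"
    and "Digraph_Component.connected G"
    and "bij_betw x {..<n} (verts G)"
  shows
    "(\<forall>q\<in>{0<..<1}. set_mset (eigenvalue_mset (transition_similarity_matrix G n x q)) \<subseteq> \<real>) \<and>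
     set_mset (eigenvalue_mset (laplacian_matrix G n x)) \<subseteq> \<real> \<and>
     (\<forall>(lam :: real \<Rightarrow> nat \<Rightarrow> real) (\<theta> :: nat \<Rightarrow> real).
        (\<forall>q\<in>{0<..<1}. antimono_on {..<n} (lam q) \<and>
           lists_eigenvalues (transition_similarity_matrix G n x q) n (lam q)) \<longrightarrow>
        mono_on {..<n} \<theta> \<longrightarrow>
        lists_eigenvalues (laplacian_matrix G n x) n \<theta> \<longrightarrow>
        (\<forall>i<n. ((\<lambda>q. - (lam q i - 1) / q) \<longlongrightarrow> \<theta> i) (at_right 0)))"
proof (intro conjI allI ballI impI)
  interpret graph G by fact
  let ?P = "transition_similarity_matrix G n x" and ?L = "laplacian_matrix G n x"
  define d where "d i j = graph_dist G (x i) (x j)" for i j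
  have inj: "x i = x j \<longleftrightarrow> i = j" if "i < n" "j < n" for i j
    using assms(3) that by (auto simp: bij_betw_def inj_on_def)
  have reach: "x i \<rightarrow>\<^sup>*\<^bsub>G\<^esub> x j" if "i < n" "j < n" for i j
    using symmetric_connected_imp_strongly_connected[OF sym_arcs assms(2)] assms(3) that
    by (auto simp: strongly_connected_def bij_betw_def)
  have d_0: "d i j = 0 \<longleftrightarrow> i = j" if "i < n" "j < n" for i j
    using graph_dist_eq_0_iff[OF reach] inj that by (simp add: d_def)
  have d_1: "d i j = 1 \<longleftrightarrow> x i \<rightarrow>\<^bsub>G\<^esub> x j" if "i < n" "j < n" for i j
  proof (cases "i = j")
    case True
    thus ?thesis using d_0[of i j] that by (auto dest: adj_not_same)
  next
    case False
    thus ?thesis using graph_dist_eq_1_iff[OF reach] inj that by (simp add: d_def)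
  qed
  have P: "?P q \<in> carrier_mat n n"
    "i < n \<Longrightarrow> j < n \<Longrightarrow> ?P q $$ (i, j) = q ^ d i j / (\<Sum>k<n. q ^ d i k)" for q i j
    by (simp_all add: transition_similarity_matrix_def d_def)
  \<comment> \<open>This matches the degree with the diagonal limit in
    \<open>tendsto_transition_entry\<close>.\<close>
  have deg: "out_degree G (x i) = card {k. k < n \<and> d i k = 1}" if "i < n" for i
  proof -
    have "{v. x i \<rightarrow>\<^bsub>G\<^esub> v} = x ` {k. k < n \<and> d i k = 1}"
    proof (intro equalityI subsetI)
      fix v assume "v \<in> {v. x i \<rightarrow>\<^bsub>G\<^esub> v}"
      moreover from this obtain k where "k < n" "v = x k"
        using assms(3) adj_in_verts(2) by (fastforce simp: bij_betw_def)
      ultimately show "v \<in> x ` {k. k < n \<and> d i k = 1}" using d_1 that by auto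
    qed (use d_1 that in auto)
    moreover have "inj_on x {k. k < n \<and> d i k = 1}"
      using inj by (auto simp: inj_on_def)
    ultimately show ?thesis by (simp add: out_degree_eq_card card_image)
  qed
  have L: "?L \<in> carrier_mat n n"
    "i < n \<Longrightarrow> j < n \<Longrightarrow> ?L $$ (i, j) =
      (if i = j then real (card {k. k < n \<and> d i k = 1}) else - (if d i j = 1 then 1 else 0))" for i j
  proof -
    show "?L \<in> carrier_mat n n"
      by (simp add: laplacian_matrix_def adjacency_matrix_def minus_carrier_mat)
    show "?L $$ (i, j) = (if i = j then real (card {k. k < n \<and> d i k = 1}) else - (if d i j = 1 then 1 else 0))"
      if "i < n" "j < n"
      using that d_0[OF that] d_1[OF that]
      by (cases "i = j") (simp_all add: laplacian_matrix_def degree_matrix_def adjacency_matrix_def deg)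
  qed
  show "set_mset (eigenvalue_mset (?P q)) \<subseteq> \<real>" if q: "q \<in> {0<..<1}" for q
  proof (rule eigenvalues_real_if_symmetrizable[OF P(1)])
    \<comment> \<open>Multiplying row \<open>i\<close> by its normalising sum leaves
      \<open>q ^ d i j\<close>, which is symmetric.\<close>
    define s where "s i = (\<Sum>k<n. q ^ d i k)" for i
    show s_pos: "s i > 0" if "i < n" for i
      unfolding s_def using q that by (intro sum_pos) auto
    show "s i * ?P q $$ (i, j) = s j * ?P q $$ (j, i)" if "i < n" "j < n" for i j
      using that s_pos[of i] s_pos[of j] graph_dist_commute[of "x i" "x j"]
      by (simp add: P(2) s_def[symmetric]) (simp add: d_def)
  qed
  show "set_mset (eigenvalue_mset ?L) \<subseteq> \<real>"
    by (rule eigenvalues_real_if_symmetrizable[OF L(1), of "\<lambda>_. 1"])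
       (auto simp: L(2) d_def graph_dist_commute)
  fix lam :: "real \<Rightarrow> nat \<Rightarrow> real" and \<theta> :: "nat \<Rightarrow> real" and i
  assume lam: "\<forall>q\<in>{0<..<1}. antimono_on {..<n} (lam q) \<and> lists_eigenvalues (?P q) n (lam q)"
    and \<theta>: "mono_on {..<n} \<theta>" "lists_eigenvalues ?L n \<theta>" and i: "i < n"
  \<comment> \<open>For positive \<open>q\<close> the minus sign turns the decreasing order of
    \<open>lam q\<close> into the increasing order of \<theta>.\<close>
  define \<mu> where "\<mu> q j = - (lam q j - 1) / q" for q j
  have ev: "eventually (\<lambda>q::real. q \<in> {0<..<1}) (at_right 0)"
    by (intro eventually_at_right_real) simp
  show "((\<lambda>q. - (lam q i - 1) / q) \<longlongrightarrow> \<theta> i) (at_right 0)"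
    unfolding \<mu>_def[symmetric]
  proof (rule tendsto_sorted_roots[OF _ \<theta>(1) _ i])
    show "eventually (\<lambda>q. mono_on {..<n} (\<mu> q)) (at_right 0)"
      using ev
    proof eventually_elim
      case (elim q)
      show ?case
      proof (rule mono_onI)
        fix j k assume "j \<in> {..<n}" "k \<in> {..<n}" "j \<le> k"
        hence "lam q k \<le> lam q j" using lam elim by (auto simp: monotone_on_def)
        thus "\<mu> q j \<le> \<mu> q k" using elim by (auto simp: \<mu>_def intro: divide_right_mono)
      qed
    qed
  next
    fix z :: complex
    \<comment> \<open>The entries of \<open>(I - P(q)) / q\<close>, whose eigenvalues should be the
      \<open>\<mu> q j\<close>.\<close>
    define M where "M q j k = ((if j = k then 1 else 0) - q ^ d j k / (\<Sum>l<n. q ^ d j l)) / q"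
      for q :: real and j k
    have "((\<lambda>q. (if j = k then z else 0) - complex_of_real (M q j k)) \<longlongrightarrow>
        (if j = k then z else 0) - complex_of_real (?L $$ (j, k))) (at_right 0)"
      if "j < n" "k < n" for j k
      unfolding M_def L(2)[OF that]
      by (intro tendsto_diff tendsto_const tendsto_of_real tendsto_transition_entry d_0 that)
    hence "((\<lambda>q. det (mat n n (\<lambda>(j, k). (if j = k then z else 0) - complex_of_real (M q j k)))) \<longlongrightarrow>
        (\<Prod>j<n. z - complex_of_real (\<theta> j))) (at_right 0)"
      unfolding lists_eigenvalues_prod[OF L(1) \<theta>(2)] by (rule tendsto_det_mat)
    moreover have "eventually (\<lambda>q. det (mat n n (\<lambda>(j, k). (if j = k then z else 0) - complex_of_real (M q j k))) =
        (\<Prod>j<n. z - complex_of_real (\<mu> q j))) (at_right 0)"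
      using ev
    proof eventually_elim
      case (elim q)
      let ?q = "complex_of_real q"
      let ?D = "det (mat n n (\<lambda>(j, k). (if j = k then z else 0) - complex_of_real (M q j k)))"
      have q: "?q \<noteq> 0" using elim by simp
      \<comment> \<open>The factor \<open>- q\<close> turns \<open>z - \<mu> q j\<close> into
        \<open>(1 - q z) - lam q j\<close>, so the characteristic determinant of \<open>P(q)\<close>
        is evaluated at \<open>1 - q z\<close>. The nonzero power of \<open>- q\<close> cancels at
        the end.\<close>
      have "(- ?q) ^ n * (\<Prod>j<n. z - complex_of_real (\<mu> q j)) =
          (\<Prod>j<n. (1 - ?q * z) - complex_of_real (lam q j))"
      proof -
        have "(- ?q) ^ n * (\<Prod>j<n. z - complex_of_real (\<mu> q j)) =
            (\<Prod>j<n. - ?q * (z - complex_of_real (\<mu> q j)))"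
          by (subst prod.distrib) simp
        also have "\<dots> = (\<Prod>j<n. (1 - ?q * z) - complex_of_real (lam q j))"
          using q by (intro prod.cong refl) (simp add: \<mu>_def field_simps)
        finally show ?thesis .
      qed
      also have "\<dots> = det (mat n n (\<lambda>(j, k). (if j = k then 1 - ?q * z else 0) - complex_of_real (?P q $$ (j, k))))"
        using lam elim by (intro lists_eigenvalues_prod P) auto
      also have "\<dots> = (- ?q) ^ n * det (mat n n (\<lambda>(j, k). (if j = k then z else 0) -
          ((if j = k then 1 else 0) - complex_of_real (?P q $$ (j, k))) / ?q))"
        using q by (rule det_char_shift)
      also have "mat n n (\<lambda>(j, k). (if j = k then z else 0) -
          ((if j = k then 1 else 0) - complex_of_real (?P q $$ (j, k))) / ?q) =
          mat n n (\<lambda>(j, k). (if j = k then z else 0) - complex_of_real (M q j k))"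
        by (rule eq_matI) (auto simp: P(2) M_def)
      finally show ?case using q by simp
    qed
    ultimately show "((\<lambda>q. \<Prod>j<n. z - complex_of_real (\<mu> q j)) \<longlongrightarrow> (\<Prod>j<n. z - complex_of_real (\<theta> j))) (at_right 0)"
      by (rule Lim_transform_eventually)
  qed
qed

end
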